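(* Let $G$ be a graph of genus $g$ and let $\mathfrak{C}$ be a cycle orientation configuration of $G$. The following are equivalent: (i) $\mathfrak{C}$ is geometric; (ii) there exists a spanning tree $T$ of $G$, with $e_1,\ldots,e_g$ the edges not in $T$, and real weights $\alpha_1,\ldots,\alpha_g$ such that for every cycle $C$ of $G$, oriented as in $\mathfrak{C}$, $\sum_{e_i\in C}\operatorname{sign}(C,e_i)\alpha_i>0$; (iii) for every spanning tree $T$ of $G$, with $e_1,\ldots,e_g$ the edges not in $T$, there exist such weights $\alpha_1,\ldots,\alpha_g$.
   Context: Graphs are finite and connected, possibly with parallel edges but without loops; cycles are simple cycles; $g=|E|-|V|+1$. Each edge has a fixed reference orientation. For an oriented cycle $C$ and edge $e\in C$, $\operatorname{sign}(C,e)=1$ if $e$ is traversed by $C$ in its reference direction and $-1$ otherwise; $C$ is identified with $\sum_{e\in C}\operatorname{sign}(C,e)e\in C_1(G,\mathbb{R})$, the real vector space with orthonormal basis $E(G)$. $H_1(G,\mathbb{R})\subset C_1(G,\mathbb{R})$ is the span of all cycles. A cycle orientation configuration is an assignment of an orientation to each cycle of $G$. It is called geometric if there exists $\mathbf{w}\in H_1(G,\mathbb{R})$ with $\langle\mathbf{w},C\rangle>0$ for every cycle $C$ oriented as in the configuration (equivalently, it arises from shifting the polyhedral decomposition of the tropical Jacobian along a generic vector $\mathbf{w}$). *)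

theory Defs
  imports "HOL-Analysis.Analysis" "Graph_Theory.Graph_Theory"
begin

text \<open>
  A multigraph with a fixed reference orientation is a \<open>pre_digraph\<close>: every edge is an arc,
  directed from \<open>tail\<close> to \<open>head\<close>, and parallel edges are distinct arcs. The edges are taken
  from a finite type \<open>'e\<close>, so that the space of 1-chains is a subspace of \<open>real ^ 'e\<close>, with
  the edges as orthonormal basis vectors; \<open>arcs G\<close> may be a proper subset of \<open>'e\<close>.
\<close>

text \<open>The subtraction on \<open>nat\<close> does not truncate when \<open>G\<close> is connected.\<close>
definition genus :: "('v, 'e) pre_digraph \<Rightarrow> nat" where
  "genus G = (card (arcs G) + 1) - card (verts G)"

text \<open>
  Walks that may use edges against their reference direction are walks in the digraph in which
  each edge \<open>e\<close> is replaced by \<open>(e, True)\<close>, its forward traversal, and \<open>(e, False)\<close>, its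
  backward traversal.
\<close>
definition traversals :: "('v, 'e) pre_digraph \<Rightarrow> ('v, 'e \<times> bool) pre_digraph" where
  "traversals G = \<lparr>verts = verts G, arcs = arcs G \<times> UNIV,
     tail = (\<lambda>(e, fwd). if fwd then tail G e else head G e),
     head = (\<lambda>(e, fwd). if fwd then head G e else tail G e)\<rparr>"

text \<open>
  An oriented simple cycle is the set of edge traversals of a closed walk without repeated
  vertices; taking the set forgets the starting point. Distinctness of the edges excludes
  going forth and back along a single edge.
\<close>
definition oriented_cycles :: "('v, 'e) pre_digraph \<Rightarrow> ('e \<times> bool) set set" where
  "oriented_cycles G =
     {set p | p. pre_digraph.cycle (traversals G) p \<and> distinct (map fst p)}"

text \<open>An unoriented cycle is represented by its set of edges.\<close>
definition cycles :: "('v, 'e) pre_digraph \<Rightarrow> 'e set set" where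
  "cycles G = (\<lambda>C. fst ` C) ` oriented_cycles G"

text \<open>Only meaningful for an edge \<open>e\<close> of \<open>C\<close>.\<close>
definition cycle_sign :: "('e \<times> bool) set \<Rightarrow> 'e \<Rightarrow> real" where
  "cycle_sign C e = (if (e, True) \<in> C then 1 else - 1)"

definition cycle_chain :: "('e::finite \<times> bool) set \<Rightarrow> real ^ 'e" where
  "cycle_chain C = (\<Sum>e\<in>fst ` C. cycle_sign C e *\<^sub>R axis e 1)"

definition H1 :: "('v, 'e::finite) pre_digraph \<Rightarrow> (real ^ 'e) set" where
  "H1 G = span (cycle_chain ` oriented_cycles G)"

definition cycle_orientation_config ::
    "('v, 'e) pre_digraph \<Rightarrow> ('e set \<Rightarrow> ('e \<times> bool) set) \<Rightarrow> bool" where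
  "cycle_orientation_config G \<CC> \<longleftrightarrow>
     (\<forall>C\<in>cycles G. \<CC> C \<in> oriented_cycles G \<and> fst ` \<CC> C = C)"

definition geometric ::
    "('v, 'e::finite) pre_digraph \<Rightarrow> ('e set \<Rightarrow> ('e \<times> bool) set) \<Rightarrow> bool" where
  "geometric G \<CC> \<longleftrightarrow> (\<exists>w\<in>H1 G. \<forall>C\<in>cycles G. w \<bullet> cycle_chain (\<CC> C) > 0)"

text \<open>
  The existing constant \<^const>\<open>spanning_tree\<close> only excludes directed cycles of the digraph
  and would accept, say, an acyclically oriented triangle. Here cycles are those of the
  underlying undirected graph. The qualified constant for connectedness is the one of
  digraphs (connectedness of the underlying undirected graph), not the topological one.
\<close>
definition undirected_spanning_tree ::
    "('v, 'e) pre_digraph \<Rightarrow> ('v, 'e) pre_digraph \<Rightarrow> bool" where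
  "undirected_spanning_tree T G \<longleftrightarrow>
     spanning T G \<and> Digraph_Component.connected T \<and> cycles T = {}"

end

(*
  Any weight vector on the edges can be projected orthogonally to H1 without changing its inner
  products with the cycles, so weights on the edges outside a tree yield a vector w in H1.
  Conversely, a circulation supported on a spanning tree vanishes, so a circulation is determined
  by its values outside the tree, and every linear functional on H1, such as the inner product
  with w, factors through these values.
*)
theory Submission
  imports Defs
begin

section \<open>Circulations and cycle chains\<close>

text \<open>
  Kirchhoff's law, summed against an arbitrary potential \<open>f\<close> on the vertices; an indicator
  function \<open>f\<close> gives the law at a single vertex.
\<close>
definition circulation :: "('v, 'e::finite) pre_digraph \<Rightarrow> real ^ 'e \<Rightarrow> bool" where
  "circulation G z \<longleftrightarrow> (\<forall>e. e \<notin> arcs G \<longrightarrow> z $ e = 0) \<and>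
     (\<forall>f. (\<Sum>e\<in>arcs G. z $ e * (f (head G e) - f (tail G e))) = 0)"

lemma subspace_circulation: "subspace {z. circulation G z}"
  unfolding circulation_def subspace_def
  by (auto simp: algebra_simps sum.distrib sum_subtractf simp flip: sum_distrib_left)

text \<open>The terms for arcs outside \<open>T\<close> vanish, so both Kirchhoff sums agree. Serves
  to move a circulation of \<open>G\<close> onto a tree.\<close>

lemma circulation_subgraph:
  assumes "circulation G z" "subgraph T G" "\<And>e. e \<notin> arcs T \<Longrightarrow> z $ e = 0"
  shows "circulation T z"
proof -
  have T: "arcs T \<subseteq> arcs G" "tail T = tail G" "head T = head G"
    using assms(2) by (auto simp: subgraph_def compatible_def)
  have "(\<Sum>e\<in>arcs T. z $ e * (f (head G e) - f (tail G e))) =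
        (\<Sum>e\<in>arcs G. z $ e * (f (head G e) - f (tail G e)))" for f
    by (rule sum.mono_neutral_left) (use T(1) assms(3) in auto)
  with assms T show ?thesis by (simp add: circulation_def)
qed

lemma cycle_chain_nth:
  "cycle_chain C $ e = (if e \<in> fst ` C then cycle_sign C e else 0)"
  by (simp add: cycle_chain_def axis_def if_distrib cong: if_cong)

lemma oriented_cycleE:
  assumes "C \<in> oriented_cycles G"
  obtains p u where "C = set p" "distinct (map fst p)" "p \<noteq> []" "set p \<subseteq> arcs (traversals G)"
    "pre_digraph.cas (traversals G) u p u"
  using assms by (auto simp: oriented_cycles_def pre_digraph.cycle_def pre_digraph.awalk_def)

text \<open>The sum telescopes; on a closed walk it is zero, which is Kirchhoff's law for a
  cycle.\<close>

lemma cas_sum_potential: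
  fixes f :: "'v \<Rightarrow> real"
  assumes "pre_digraph.cas G u p v"
  shows "(\<Sum>a\<leftarrow>p. f (head G a) - f (tail G a)) = f v - f u"
  using assms by (induction p arbitrary: u) (auto simp: pre_digraph.cas.simps)

lemma cycle_chain_circulation:
  fixes G :: "('v, 'e::finite) pre_digraph"
  assumes "C \<in> oriented_cycles G"
  shows "circulation G (cycle_chain C)"
proof -
  from assms obtain p u where p: "C = set p" "distinct (map fst p)"
    "set p \<subseteq> arcs (traversals G)" "pre_digraph.cas (traversals G) u p u"
    by (rule oriented_cycleE)
  have inj: "inj_on fst C" using p by (simp add: distinct_map)
  have sub: "fst ` C \<subseteq> arcs G" using p by (auto simp: traversals_def)
  \<comment> \<open>Only one traversal of each edge lies in \<open>C\<close>, so the test for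
    \<open>(e, True)\<close> in \<open>cycle_sign\<close> recovers the direction of travel.\<close>
  have sign: "cycle_sign C (fst a) = (if snd a then 1 else - 1)" if "a \<in> C" for a
    using inj_onD[OF inj, of "(fst a, True)" a] that by (cases a) (auto simp: cycle_sign_def)
  have "(\<Sum>e\<in>arcs G. cycle_chain C $ e * (f (head G e) - f (tail G e))) = 0" for f
  proof -
    have "(\<Sum>e\<in>arcs G. cycle_chain C $ e * (f (head G e) - f (tail G e))) =
          (\<Sum>e\<in>fst ` C. cycle_sign C e * (f (head G e) - f (tail G e)))"
      by (rule sum.mono_neutral_cong_right) (use sub in \<open>auto simp: cycle_chain_nth\<close>)
    \<comment> \<open>The sign turns the difference along the reference direction into the
      difference along the traversal.\<close>
    also have "\<dots> = (\<Sum>a\<in>C. f (head (traversals G) a) - f (tail (traversals G) a))"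
      unfolding sum.reindex[OF inj]
      by (rule sum.cong) (auto simp: sign traversals_def)
    also have "\<dots> = (\<Sum>a\<leftarrow>p. f (head (traversals G) a) - f (tail (traversals G) a))"
      using p by (simp add: sum_list_distinct_conv_sum_set distinct_map)
    also have "\<dots> = 0" using cas_sum_potential[OF p(4), of f] by simp
    finally show ?thesis .
  qed
  with sub show ?thesis by (auto simp: circulation_def cycle_chain_nth)
qed

lemma H1_circulation: "z \<in> H1 G \<Longrightarrow> circulation G z"
  unfolding H1_def
  using span_induct[OF _ subspace_circulation, of z "cycle_chain ` oriented_cycles G" G]
    cycle_chain_circulation[of _ G] by auto

section \<open>Acyclicity as the vanishing of all circulations\<close>

text \<open>The chain of a cycle would be a nonzero circulation, having entries 1 or -1 on its
  edges.\<close>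

lemma circulation_zero_imp_acyclic:
  assumes "\<And>z. circulation T z \<Longrightarrow> z = 0"
  shows "cycles T = {}"
proof (rule ccontr)
  assume "cycles T \<noteq> {}"
  then obtain C where C: "C \<in> oriented_cycles T" by (auto simp: cycles_def)
  then obtain a where "a \<in> C" by (metis oriented_cycleE last_in_set)
  moreover have "cycle_chain C $ fst a = 0"
    using assms[OF cycle_chain_circulation[OF C]] by simp
  ultimately show False by (auto simp: cycle_chain_nth cycle_sign_def split: if_splits)
qed

text \<open>
  The arcs are oriented along the flow. If this orientation had no directed cycle, the number of
  strict predecessors would be a potential that increases along the flow, and pairing it with the
  circulation would give a positive number.
\<close>
lemma acyclic_imp_circulation_zero:
  fixes T :: "('v, 'e::finite) pre_digraph"
  assumes "wf_digraph T" and cyc: "cycles T = {}" and circ: "circulation T z"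
  shows "z = 0"
proof (rule ccontr)
  assume "z \<noteq> 0"
  interpret T: wf_digraph T by fact
  \<comment> \<open>Edges with \<open>z $ e = 0\<close> are dropped and each other edge keeps a
    single direction. Hence \<open>fst\<close> is injective on \<open>arcs P\<close>, and a directed
    cycle of \<open>P\<close> never goes back along an edge.\<close>
  define P where "P = \<lparr>verts = verts T,
    arcs = {(e, b). e \<in> arcs T \<and> (if b then z $ e > 0 else z $ e < 0)},
    tail = tail (traversals T), head = head (traversals T)\<rparr>"
  interpret P: wf_digraph P
    by unfold_locales (auto simp: P_def traversals_def split: if_splits)
  have comp: "compatible P (traversals T)" by (simp add: compatible_def P_def)
  have inj: "inj_on fst (arcs P)" by (auto simp: inj_on_def P_def split: if_splits)
  have "acyclic (arcs_ends P)"
    unfolding acyclic_def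
  proof (intro allI notI)
    fix v assume "(v, v) \<in> (arcs_ends P)\<^sup>+"
    then obtain p where "P.awalk v p v" "p \<noteq> []" using P.reachable1_awalk by blast
    then have "P.closed_w p" by (auto simp: P.closed_w_def)
    then obtain q where q: "P.cycle q" using P.closed_w_imp_cycle by blast
    then obtain u where u: "P.awalk u q u" "distinct (tl (P.awalk_verts u q))" "q \<noteq> []"
      by (auto simp: P.cycle_def)
    have "distinct q" using P.distinct_tl_verts_imp_distinct u by blast
    moreover have "set q \<subseteq> arcs P" using u by auto
    ultimately have "distinct (map fst q)"
      using inj by (auto simp: distinct_map intro: inj_on_subset)
    moreover have "pre_digraph.cycle (traversals T) q"
      unfolding pre_digraph.cycle_def pre_digraph.awalk_def
      using u compatible_cas[OF comp] compatible_awalk_verts[OF comp]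
      by (auto simp: P.awalk_def intro!: exI[of _ u]) (auto simp: P_def traversals_def)
    ultimately have "set q \<in> oriented_cycles T" by (auto simp: oriented_cycles_def)
    then show False using cyc by (auto simp: cycles_def)
  qed
  define f where "f v = real (card {u. (u, v) \<in> (arcs_ends P)\<^sup>+})" for v
  have fin: "finite (arcs_ends P)" by (simp add: arcs_ends_def)
  have mono: "f u < f v" if "(u, v) \<in> arcs_ends P" for u v
  proof -
    \<comment> \<open>The inclusion is strict: \<open>u\<close> precedes \<open>v\<close> but, by
      acyclicity, not itself.\<close>
    have "{w. (w, u) \<in> (arcs_ends P)\<^sup>+} \<subset> {w. (w, v) \<in> (arcs_ends P)\<^sup>+}"
      using that \<open>acyclic (arcs_ends P)\<close> by (auto simp: acyclic_def intro: trancl_into_trancl)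
    moreover have "finite {w. (w, v) \<in> (arcs_ends P)\<^sup>+}"
      by (rule finite_subset[of _ "Domain (arcs_ends P)"])
         (auto simp: fin finite_Domain dest: tranclD)
    ultimately show ?thesis by (simp add: f_def psubset_card_mono)
  qed
  have pos: "z $ e * (f (head T e) - f (tail T e)) > 0" if "e \<in> arcs T" "z $ e \<noteq> 0" for e
  proof (cases "z $ e > 0")
    case True
    with that have "(e, True) \<in> arcs P" by (simp add: P_def)
    then have "(tail P (e, True), head P (e, True)) \<in> arcs_ends P"
      by (rule P.in_arcs_imp_in_arcs_ends)
    then show ?thesis using mono True by (simp add: P_def traversals_def)
  next
    case False
    with that have "(e, False) \<in> arcs P" by (simp add: P_def)
    then have "(tail P (e, False), head P (e, False)) \<in> arcs_ends P"
      by (rule P.in_arcs_imp_in_arcs_ends)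
    then have "f (head T e) < f (tail T e)" using mono by (simp add: P_def traversals_def)
    then show ?thesis using False that by (simp add: mult_neg_neg)
  qed
  obtain e where e: "z $ e \<noteq> 0" using \<open>z \<noteq> 0\<close> by (auto simp: vec_eq_iff)
  then have "e \<in> arcs T" using circ by (auto simp: circulation_def)
  moreover have "z $ a * (f (head T a) - f (tail T a)) \<ge> 0" if "a \<in> arcs T" for a
    using pos[OF that] by (cases "z $ a = 0") (auto intro: less_imp_le)
  ultimately have "(\<Sum>e\<in>arcs T. z $ e * (f (head T e) - f (tail T e))) > 0"
    using e pos by (intro sum_pos2[of _ e]) auto
  then show False using circ by (simp add: circulation_def)
qed

section \<open>Connectedness and existence of a spanning tree\<close>

text \<open>Phrases connectedness by a reflexive transitive closure, to which induction and
  monotonicity apply directly.\<close>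

lemma connected_conv:
  assumes "wf_digraph G"
  shows "Digraph_Component.connected G \<longleftrightarrow> verts G \<noteq> {} \<and>
    (\<forall>u\<in>verts G. \<forall>v\<in>verts G. (u, v) \<in> (parcs (mk_symmetric G))\<^sup>*)"
proof -
  interpret S: pair_wf_digraph "mk_symmetric G"
    using assms by (rule wf_digraph.wellformed_mk_symmetric)
  show ?thesis
    by (auto simp: connected_def strongly_connected_def S.reachable_conv)
qed

text \<open>A path from inside \<open>S\<close> to outside must step across the boundary. The arc
  found may point either way, hence the equivalence in the conclusion.\<close>

lemma connected_crossing_arc:
  assumes "wf_digraph G" "Digraph_Component.connected G" "S \<subset> verts G" "S \<noteq> {}"
  obtains e where "e \<in> arcs G" "tail G e \<in> S \<longleftrightarrow> head G e \<notin> S"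
proof -
  obtain u v where uv: "u \<in> S" "v \<in> verts G" "v \<notin> S" using assms by blast
  then have "(u, v) \<in> (parcs (mk_symmetric G))\<^sup>*"
    using assms connected_conv by blast
  \<comment> \<open>Induction along the path: if the previous vertex is in \<open>S\<close>, the
    last step crosses; otherwise the induction hypothesis applies.\<close>
  then have "\<exists>e\<in>arcs G. tail G e \<in> S \<longleftrightarrow> head G e \<notin> S" if "v \<notin> S"
    using that
    by (induction rule: rtrancl_induct) (use uv in \<open>auto simp: parcs_mk_symmetric\<close>)
  with uv that show ?thesis by blast
qed

text \<open>
  Acyclicity is expressed by the absence of nonzero circulations: a circulation vanishes on the
  new pendant edge, by Kirchhoff's law at the new leaf.
\<close>
lemma extend_tree:
  fixes G :: "('v, 'e::finite) pre_digraph"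
  assumes G: "fin_digraph G" "Digraph_Component.connected G"
    and T: "subgraph T G" "Digraph_Component.connected T" "\<And>z. circulation T z \<Longrightarrow> z = 0"
    and less: "verts T \<noteq> verts G"
  obtains T' where "subgraph T' G" "Digraph_Component.connected T'"
    "\<And>z. circulation T' z \<Longrightarrow> z = 0"
    "card (verts T') = Suc (card (verts T))" "card (arcs T') = Suc (card (arcs T))"
proof -
  interpret G: fin_digraph G by fact
  interpret T: wf_digraph T using T by (auto simp: subgraph_def)
  have TG: "verts T \<subseteq> verts G" "arcs T \<subseteq> arcs G" "tail T = tail G" "head T = head G"
    using T by (auto simp: subgraph_def compatible_def)
  have ne: "verts T \<noteq> {}" using T by (simp add: connected_conv T.wf_digraph_axioms)
  obtain e where e: "e \<in> arcs G" "tail G e \<in> verts T \<longleftrightarrow> head G e \<notin> verts T"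
    using connected_crossing_arc[of G "verts T"] G less ne TG G.wf_digraph_axioms by blast
  \<comment> \<open>\<open>x\<close> is the end of \<open>e\<close> outside \<open>T\<close>, the
    new leaf, and \<open>y\<close> the end inside, whichever way \<open>e\<close> points.\<close>
  define x where "x = (if tail G e \<in> verts T then head G e else tail G e)"
  define y where "y = (if tail G e \<in> verts T then tail G e else head G e)"
  have xy: "x \<in> verts G" "x \<notin> verts T" "y \<in> verts T" using e by (auto simp: x_def y_def)
  have ends: "tail G a \<in> verts T" "head G a \<in> verts T" if "a \<in> arcs T" for a
    using that T.wellformed TG by auto
  have eT: "e \<notin> arcs T" using e ends by blast
  define T' where "T' = \<lparr>verts = insert x (verts T), arcs = insert e (arcs T),
    tail = tail G, head = head G\<rparr>"
  have wf': "wf_digraph T'"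
    by unfold_locales (use e ends in \<open>auto simp: T'_def x_def\<close>)
  have sub: "subgraph T' G" and sub': "subgraph T T'"
    using wf' xy e TG G.wf_digraph_axioms T.wf_digraph_axioms
    by (auto simp: subgraph_def compatible_def T'_def)
  let ?R = "parcs (mk_symmetric T')"
  have sym: "{(x, y), (y, x)} \<subseteq> ?R"
    by (auto simp: parcs_mk_symmetric T'_def x_def y_def)
  have "parcs (mk_symmetric T) \<subseteq> ?R"
    using TG by (auto simp: parcs_mk_symmetric T'_def)
  then have "(parcs (mk_symmetric T))\<^sup>* \<subseteq> ?R\<^sup>*" by (rule rtrancl_mono)
  then have old: "(u, v) \<in> ?R\<^sup>*" if "u \<in> verts T" "v \<in> verts T" for u v
    using that T(2) by (auto simp: connected_conv T.wf_digraph_axioms)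
  have "Digraph_Component.connected T'"
    unfolding connected_conv[OF wf']
  proof (intro conjI ballI)
    fix u v assume uv: "u \<in> verts T'" "v \<in> verts T'"
    have "(u, y) \<in> ?R\<^sup>*" using uv(1) sym old xy by (auto simp: T'_def)
    moreover have "(y, v) \<in> ?R\<^sup>*" using uv(2) sym old xy by (auto simp: T'_def)
    ultimately show "(u, v) \<in> ?R\<^sup>*" by (rule rtrancl_trans)
  qed (simp add: T'_def)
  moreover have "z = 0" if z: "circulation T' z" for z
  proof -
    \<comment> \<open>The indicator of the leaf is the potential; \<open>e\<close> is the only arc
      of \<open>T'\<close> with an end at \<open>x\<close>.\<close>
    have "(\<Sum>a\<in>arcs T'. z $ a * (indicator {x} (head G a) - indicator {x} (tail G a))) =
        (\<Sum>a\<in>{e}. z $ a * (indicator {x} (head G a) - indicator {x} (tail G a)))"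
      by (rule sum.mono_neutral_right) (use ends xy in \<open>auto simp: T'_def indicator_def\<close>)
    moreover have "(\<Sum>a\<in>arcs T'. z $ a * (indicator {x} (head G a) - indicator {x} (tail G a))) = 0"
      using z by (simp add: circulation_def T'_def)
    ultimately have "z $ e = 0"
      using e by (auto simp: x_def indicator_def split: if_splits)
    then have "z $ a = 0" if "a \<notin> arcs T" for a
      using z that by (cases "a = e") (auto simp: circulation_def T'_def)
    then show "z = 0" using T(3) circulation_subgraph[OF z sub'] by blast
  qed
  moreover have "finite (verts T)" using TG G.finite_verts finite_subset by blast
  ultimately show ?thesis
    using that[of T'] sub xy eT by (simp add: T'_def)
qed

text \<open>A single vertex grows by one pendant edge at a time until all vertices are reached. The
  edge count later shows that exactly \<open>genus G\<close> edges lie outside the tree.\<close>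

lemma undirected_spanning_tree_exists:
  fixes G :: "('v, 'e::finite) pre_digraph"
  assumes G: "fin_digraph G" "Digraph_Component.connected G"
  obtains T where "undirected_spanning_tree T G" "card (verts G) = Suc (card (arcs T))"
proof -
  interpret G: fin_digraph G by fact
  \<comment> \<open>\<open>n\<close> counts the edges, so there are \<open>n + 1\<close> vertices;
    the last instance, \<open>n = card (verts G) - 1\<close>, is spanning.\<close>
  have "\<exists>T. subgraph T G \<and> Digraph_Component.connected T \<and> (\<forall>z. circulation T z \<longrightarrow> z = 0) \<and>
    card (verts T) = Suc n \<and> card (arcs T) = n" if "n < card (verts G)" for n
    using that
  proof (induction n)
    case 0
    then obtain r where r: "r \<in> verts G" by fastforce
    let ?T = "\<lparr>verts = {r}, arcs = {}, tail = tail G, head = head G\<rparr>"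
    have wf: "wf_digraph ?T" by unfold_locales auto
    have "subgraph ?T G"
      using wf r G.wf_digraph_axioms by (auto simp: subgraph_def compatible_def)
    moreover have "Digraph_Component.connected ?T" by (simp add: connected_conv[OF wf])
    ultimately show ?case
      by (intro exI[of _ ?T]) (auto simp: circulation_def vec_eq_iff)
  next
    case (Suc n)
    then obtain T where T: "subgraph T G" "Digraph_Component.connected T"
      "\<forall>z. circulation T z \<longrightarrow> z = 0" "card (verts T) = Suc n" "card (arcs T) = n"
      by auto
    with Suc.prems have "verts T \<noteq> verts G" by auto
    then obtain T' where "subgraph T' G" "Digraph_Component.connected T'"
        "\<And>z. circulation T' z \<Longrightarrow> z = 0"
        "card (verts T') = Suc (card (verts T))" "card (arcs T') = Suc (card (arcs T))"
      using extend_tree[OF G T(1,2)] T(3) by blast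
    with T show ?case by (intro exI[of _ T']) simp
  qed
  moreover have "card (verts G) > 0"
    using G G.wf_digraph_axioms by (simp add: connected_conv card_gt_0_iff)
  then obtain n where n: "card (verts G) = Suc n" by (cases "card (verts G)") auto
  ultimately obtain T where T: "subgraph T G" "Digraph_Component.connected T"
      "\<forall>z. circulation T z \<longrightarrow> z = 0" "card (verts T) = card (verts G)"
      "Suc (card (arcs T)) = card (verts G)"
    by (metis lessI)
  then have "verts T = verts G"
    by (intro card_subset_eq) (auto simp: subgraph_def)
  with T have "undirected_spanning_tree T G"
    by (simp add: undirected_spanning_tree_def spanning_def circulation_zero_imp_acyclic)
  with T that show ?thesis by simp
qed

section \<open>Weights as linear functionals on \<open>H1\<close>\<close>

text \<open>Edges off the cycle have coordinate zero in its chain, so the weight condition becomes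
  positivity of an inner product with one vector.\<close>

lemma weighted_sign_sum_conv_inner:
  fixes C :: "('e::finite \<times> bool) set" and e :: "'i \<Rightarrow> 'e"
  assumes "finite I"
  shows "(\<Sum>i\<in>{i\<in>I. e i \<in> fst ` C}. cycle_sign C (e i) * \<alpha> i) =
    (\<Sum>i\<in>I. \<alpha> i *\<^sub>R axis (e i) 1) \<bullet> cycle_chain C"
proof -
  have "(\<Sum>i\<in>{i\<in>I. e i \<in> fst ` C}. cycle_sign C (e i) * \<alpha> i) =
      (\<Sum>i\<in>I. \<alpha> i * cycle_chain C $ e i)"
    by (rule sum.mono_neutral_cong_left) (use assms in \<open>auto simp: cycle_chain_nth\<close>)
  then show ?thesis by (simp add: inner_sum_left inner_axis')
qed

text \<open>The witness \<open>w\<close> is the orthogonal projection of \<open>x\<close> onto the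
  span; the remainder pairs to zero with it.\<close>

lemma inner_represented_in_span:
  fixes x :: "'a::euclidean_space"
  shows "\<exists>w\<in>span S. \<forall>z\<in>span S. w \<bullet> z = x \<bullet> z"
proof (rule orthogonal_subspace_decomp_exists[of S x])
  fix w w' assume "w \<in> span S" "\<And>z. z \<in> span S \<Longrightarrow> orthogonal w' z" "x = w + w'"
  then show ?thesis by (intro bexI[of _ w]) (auto simp: inner_add_left orthogonal_def)
qed

text \<open>An element of \<open>H1 G\<close> is recovered linearly from its coordinates off
  \<open>T\<close>, so pairing with \<open>w\<close> is a linear function of these, and the \<alpha>
  are its coefficients.\<close>

lemma inner_H1_eq_nontree_weights:
  fixes G :: "('v, 'e::finite) pre_digraph" and e :: "'i \<Rightarrow> 'e"
  assumes T: "undirected_spanning_tree T G" and e: "bij_betw e I (arcs G - arcs T)"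
  obtains \<alpha> where
    "\<And>z. z \<in> H1 G \<Longrightarrow> (\<Sum>i\<in>I. \<alpha> i *\<^sub>R axis (e i) 1) \<bullet> z = w \<bullet> z"
proof -
  have sub: "subgraph T G" and cyc: "cycles T = {}" and wf: "wf_digraph T"
    using T by (auto simp: undirected_spanning_tree_def spanning_def subgraph_def)
  have fin: "finite I" using e by (auto dest: bij_betw_finite)
  define \<pi> :: "real ^ 'e \<Rightarrow> real ^ 'e" where "\<pi> z = (\<Sum>i\<in>I. z $ e i *\<^sub>R axis (e i) 1)" for z
  have lin: "linear \<pi>"
    unfolding \<pi>_def
    by (rule linearI) (simp_all add: scaleR_left_distrib sum.distrib scaleR_right.sum)
  \<comment> \<open>Trivial kernel: such a \<open>z\<close> is a circulation supported on the
    acyclic \<open>T\<close>.\<close>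
  have "z = 0" if z: "z \<in> H1 G" "\<pi> z = 0" for z
  proof -
    have nontree: "z $ e j = 0" if "j \<in> I" for j
    proof -
      have "\<pi> z $ e j = (\<Sum>i\<in>I. if i = j then z $ e j else 0)"
        unfolding \<pi>_def sum_component
        by (rule sum.cong)
           (use e that in \<open>auto simp: axis_def bij_betw_def dest: inj_onD\<close>)
      with fin that z show ?thesis by simp
    qed
    have "z $ a = 0" if "a \<notin> arcs T" for a
    proof (cases "a \<in> arcs G")
      case True
      with that e obtain j where "j \<in> I" "a = e j" by (auto simp: bij_betw_def)
      with nontree show ?thesis by simp
    next
      case False
      then show ?thesis using H1_circulation[OF z(1)] by (simp add: circulation_def)
    qed
    then show ?thesis
      using acyclic_imp_circulation_zero[OF wf cyc] circulation_subgraph[OF _ sub] H1_circulation z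
      by blast
  qed
  then have "inj_on \<pi> (H1 G)"
    by (simp add: linear_injective_on_subspace_0[OF lin] H1_def)
  then obtain h where h: "linear h" "\<And>z. z \<in> H1 G \<Longrightarrow> h (\<pi> z) = z"
    using linear_exists_left_inverse_on[OF lin, of "H1 G"] by (auto simp: H1_def)
  \<comment> \<open>The weight at \<open>e i\<close> is the functional
    \<open>w \<bullet> h _\<close> evaluated at that basis vector; expanding
    \<open>z = h (\<pi> z)\<close> by linearity gives the claim.\<close>
  have "(\<Sum>i\<in>I. (w \<bullet> h (axis (e i) 1)) *\<^sub>R axis (e i) 1) \<bullet> z = w \<bullet> z" if "z \<in> H1 G" for z
  proof -
    have "w \<bullet> z = w \<bullet> h (\<pi> z)" using h that by simp
    also have "\<dots> = (\<Sum>i\<in>I. z $ e i * (w \<bullet> h (axis (e i) 1)))"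
      by (simp add: \<pi>_def linear_sum[OF h(1)] linear_cmul[OF h(1)] inner_sum_right)
    finally show ?thesis by (simp add: inner_sum_left inner_axis' mult.commute)
  qed
  then show ?thesis by (rule that)
qed

section \<open>Equivalence of geometricity with the two weight conditions\<close>

theorem theorem3p5:
  fixes G :: "('v, 'e::finite) pre_digraph"
    and \<CC> :: "'e set \<Rightarrow> ('e \<times> bool) set"
    and g :: nat
  assumes "fin_digraph G" and "loopfree_digraph G" and "Digraph_Component.connected G"
    and "genus G = g"
    and "cycle_orientation_config G \<CC>"
  shows "(geometric G \<CC> \<longleftrightarrow>
           (\<exists>T e. undirected_spanning_tree T G \<and> bij_betw e {1..g} (arcs G - arcs T) \<and>
             (\<exists>\<alpha> :: nat \<Rightarrow> real. \<forall>C\<in>cycles G.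
               (\<Sum>i\<in>{i\<in>{1..g}. e i \<in> C}. cycle_sign (\<CC> C) (e i) * \<alpha> i) > 0)))
       \<and> (geometric G \<CC> \<longleftrightarrow>
           (\<forall>T e. undirected_spanning_tree T G \<and> bij_betw e {1..g} (arcs G - arcs T) \<longrightarrow>
             (\<exists>\<alpha> :: nat \<Rightarrow> real. \<forall>C\<in>cycles G.
               (\<Sum>i\<in>{i\<in>{1..g}. e i \<in> C}. cycle_sign (\<CC> C) (e i) * \<alpha> i) > 0)))"
proof -
  let ?W = "\<lambda>e :: nat \<Rightarrow> 'e. \<exists>\<alpha> :: nat \<Rightarrow> real. \<forall>C\<in>cycles G.
    (\<Sum>i\<in>{i\<in>{1..g}. e i \<in> C}. cycle_sign (\<CC> C) (e i) * \<alpha> i) > 0"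
  have config: "\<CC> C \<in> oriented_cycles G" "fst ` \<CC> C = C" if "C \<in> cycles G" for C
    using assms(5) that by (auto simp: cycle_orientation_config_def)
  then have H1: "cycle_chain (\<CC> C) \<in> H1 G" if "C \<in> cycles G" for C
    using that by (auto simp: H1_def intro: span_base)
  have sum_conv: "(\<Sum>i\<in>{i\<in>{1..g}. e i \<in> C}. cycle_sign (\<CC> C) (e i) * \<alpha> i) =
      (\<Sum>i\<in>{1..g}. \<alpha> i *\<^sub>R axis (e i) 1) \<bullet> cycle_chain (\<CC> C)"
    if "C \<in> cycles G" for C \<alpha> and e :: "nat \<Rightarrow> 'e"
    using weighted_sign_sum_conv_inner[where I = "{1..g}" and C = "\<CC> C"] config(2)[OF that] by simp
  have weights_of_geometric: "?W e"
    if geo: "geometric G \<CC>" and T: "undirected_spanning_tree T G"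
      and e: "bij_betw e {1..g} (arcs G - arcs T)" for T e
  proof -
    obtain w where w: "\<And>C. C \<in> cycles G \<Longrightarrow> w \<bullet> cycle_chain (\<CC> C) > 0"
      using geo by (auto simp: geometric_def)
    obtain \<alpha> where \<alpha>: "\<And>z. z \<in> H1 G \<Longrightarrow> (\<Sum>i\<in>{1..g}. \<alpha> i *\<^sub>R axis (e i) 1) \<bullet> z = w \<bullet> z"
      using inner_H1_eq_nontree_weights[OF T e] by blast
    show ?thesis
    proof (intro exI[of _ \<alpha>] ballI)
      fix C assume C: "C \<in> cycles G"
      show "(\<Sum>i\<in>{i\<in>{1..g}. e i \<in> C}. cycle_sign (\<CC> C) (e i) * \<alpha> i) > 0"
        unfolding sum_conv[OF C] \<alpha>[OF H1[OF C]] by (rule w[OF C])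
    qed
  qed
  \<comment> \<open>Projecting the weight vector to \<open>H1 G\<close> preserves its pairing with
    each cycle chain.\<close>
  have geometric_of_weights: "geometric G \<CC>" if "?W e" for e
  proof -
    from that obtain \<alpha> where pos: "\<forall>C\<in>cycles G.
        (\<Sum>i\<in>{i\<in>{1..g}. e i \<in> C}. cycle_sign (\<CC> C) (e i) * \<alpha> i) > 0"
      by blast
    have \<alpha>: "(\<Sum>i\<in>{1..g}. \<alpha> i *\<^sub>R axis (e i) 1) \<bullet> cycle_chain (\<CC> C) > 0"
      if "C \<in> cycles G" for C
      using pos that unfolding sum_conv[OF that, symmetric] by blast
    obtain w where w: "w \<in> H1 G"
      "\<forall>z\<in>H1 G. w \<bullet> z = (\<Sum>i\<in>{1..g}. \<alpha> i *\<^sub>R axis (e i) 1) \<bullet> z"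
      unfolding H1_def
      by (rule inner_represented_in_span[of "cycle_chain ` oriented_cycles G", THEN bexE])
    have "w \<bullet> cycle_chain (\<CC> C) > 0" if "C \<in> cycles G" for C
      unfolding bspec[OF w(2) H1[OF that]] by (rule \<alpha>[OF that])
    with w(1) show ?thesis unfolding geometric_def by blast
  qed
  \<comment> \<open>Some tree with an enumeration of its complement must exist: it witnesses (ii),
    and without it (iii) could hold vacuously.\<close>
  obtain T where T: "undirected_spanning_tree T G" "card (verts G) = Suc (card (arcs T))"
    using undirected_spanning_tree_exists[OF assms(1,3)] .
  have "arcs T \<subseteq> arcs G"
    using T by (auto simp: undirected_spanning_tree_def spanning_def subgraph_def)
  \<comment> \<open>With \<open>card (verts G) = Suc (card (arcs T))\<close>, the \<open>+ 1\<close>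
    in the genus cancels.\<close>
  then have "card (arcs G - arcs T) = g"
    using T assms(4) by (simp add: card_Diff_subset genus_def)
  then obtain e where e: "bij_betw e {1..g} (arcs G - arcs T)"
    using finite_same_card_bij[of "{1..g}" "arcs G - arcs T"] by auto
  show ?thesis
  proof (intro conjI iffI allI impI)
    assume "geometric G \<CC>"
    then have "?W e" using T(1) e by (rule weights_of_geometric)
    with T(1) e show "\<exists>T e. undirected_spanning_tree T G \<and>
        bij_betw e {1..g} (arcs G - arcs T) \<and> ?W e"
      by (intro exI[of _ T] exI[of _ e] conjI)
  next
    fix T e
    assume "geometric G \<CC>" "undirected_spanning_tree T G \<and> bij_betw e {1..g} (arcs G - arcs T)"
    then show "?W e" by (elim conjE) (rule weights_of_geometric)
  next
    assume "\<exists>T e. undirected_spanning_tree T G \<and> bij_betw e {1..g} (arcs G - arcs T) \<and> ?W e"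
    then obtain T e where "undirected_spanning_tree T G \<and> bij_betw e {1..g} (arcs G - arcs T) \<and> ?W e"
      by (elim exE)
    then show "geometric G \<CC>" by (intro geometric_of_weights[of e]) (elim conjE)
  next
    assume "\<forall>T e. undirected_spanning_tree T G \<and> bij_betw e {1..g} (arcs G - arcs T) \<longrightarrow> ?W e"
    then have "?W e" using conjI[OF T(1) e] by (rule spec[of _ T, THEN spec[of _ e], THEN mp])
    then show "geometric G \<CC>" by (rule geometric_of_weights)
  qed
qed

end
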